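(* Let $1\le k\le n$ be integers, and let $(q_1,\ldots,q_n)$ be such that $q_j=\frac{2k}{k+1}$ for exactly $k$ of the indices $j\in\{1,\ldots,n\}$ (in arbitrary positions) and $q_j=2$ for the remaining $n-k$ indices $j$ (if $k=n$, all $q_j=\frac{2n}{n+1}$). Let $K_{q_1\ldots q_n}$ denote the optimal (smallest) constant $K$ such that $$\left(\sum_{i_1=1}^{\infty}\left(\sum_{i_2=1}^{\infty}\left(\cdots\left(\sum_{i_{n-1}=1}^{\infty}\left(\sum_{i_n=1}^{\infty}|A(e_{i_1},\ldots,e_{i_n})|^{q_n}\right)^{\frac{q_{n-1}}{q_n}}\right)^{\frac{q_{n-2}}{q_{n-1}}}\cdots\right)^{\frac{q_2}{q_3}}\right)^{\frac{q_1}{q_2}}\right)^{\frac1{q_1}}\le K\|A\|$$ for all continuous $n$-linear forms $A:c_0\times\cdots\times c_0\to\mathbb{K}$. Then $$K_{q_1\ldots q_n}\le C_k\left(A_{\frac{2k}{k+1}}\right)^{-(n-k)}\quad\text{if }\mathbb{K}=\mathbb{R},\qquad K_{q_1\ldots q_n}\le \widetilde{C_k}\left(\widetilde{A_{\frac{2k}{k+1}}}\right)^{-(n-k)}\quad\text{if }\mathbb{K}=\mathbb{C}.$$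
   Context: Here $c_0$ is the Banach space (over $\mathbb{K}=\mathbb{R}$ or $\mathbb{C}$) of $\mathbb{K}$-valued null sequences with the sup norm, $(e_i)_{i\ge1}$ are its canonical vectors, and $\|A\|=\sup\{|A(x_1,\ldots,x_n)|:\|x_j\|\le 1\}$ for an $n$-linear form $A$. Bohnenblust--Hille constants: for a positive integer $m$, $C_m$ (for $\mathbb{K}=\mathbb{R}$) and $\widetilde{C_m}$ (for $\mathbb{K}=\mathbb{C}$) denote the optimal (smallest) constants $C$ in the classical multilinear Bohnenblust--Hille inequality $$\left(\sum_{i_1,\ldots,i_m=1}^{\infty}|A(e_{i_1},\ldots,e_{i_m})|^{\frac{2m}{m+1}}\right)^{\frac{m+1}{2m}}\le C\|A\|$$ for all continuous $m$-linear forms $A:c_0\times\cdots\times c_0\to\mathbb{K}$ (these constants are known to be finite). Khinchin constants: for $p\in[1,2]$, $A_p$ is the optimal (largest) constant such that $$A_p\left(\sum_{i=1}^N|a_i|^2\right)^{1/2}\le\left(\mathbb{E}\left|\sum_{i=1}^N a_i\varepsilon_i\right|^p\right)^{1/p}$$ for all $N\ge1$ and all real $a_1,\ldots,a_N$, where the $\varepsilon_i$ are independent Rademacher variables (uniform on $\{-1,1\}$). Likewise, $\widetilde{A_p}$ is the optimal (largest) constant in the same inequality for all complex $a_1,\ldots,a_N$, with the $\varepsilon_i$ replaced by independent Steinhaus variables (uniform on the unit circle of $\mathbb{C}$). *)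

theory Defs
  imports "HOL-Probability.Probability"
begin

section \<open>The Banach space of null sequences\<close>

text \<open>
  The scalar field is a type \<open>'a\<close>, to be instantiated with \<^typ>\<open>real\<close> or \<^typ>\<open>complex\<close>.
  As \<^typ>\<open>nat\<close> is discrete, \<open>nat \<Rightarrow>\<^sub>C 'a\<close> is the space of bounded sequences with the sup norm.
  Coordinates of sequences and positions of variables are counted from 0.
\<close>

definition c0 :: "(nat \<Rightarrow>\<^sub>C 'a::real_normed_field) set" where
  "c0 = {x. apply_bcontfun x \<longlonglongrightarrow> 0}"

text \<open>The library only provides multiplication of a bounded sequence by real scalars.\<close>

definition scale_seq :: "'a::real_normed_field \<Rightarrow> (nat \<Rightarrow>\<^sub>C 'a) \<Rightarrow> (nat \<Rightarrow>\<^sub>C 'a)" where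
  "scale_seq c x = Bcontfun (\<lambda>i. c * apply_bcontfun x i)"

lemma apply_scale_seq [simp]: "apply_bcontfun (scale_seq c x) i = c * apply_bcontfun x i"
proof -
  have "(\<lambda>i. c * apply_bcontfun x i) \<in> bcontfun"
    by (rule bcontfun_normI[where b = "norm c * norm x"])
       (auto simp: norm_mult intro: mult_left_mono norm_bounded)
  then show ?thesis by (simp add: scale_seq_def Bcontfun_inverse)
qed

definition unit_seq :: "nat \<Rightarrow> (nat \<Rightarrow>\<^sub>C 'a::real_normed_field)" where
  "unit_seq i = Bcontfun (\<lambda>j. if j = i then 1 else 0)"

lemma apply_unit_seq [simp]: "apply_bcontfun (unit_seq i) j = (if j = i then 1 else 0)"
proof -
  have "(\<lambda>j. if j = i then 1 else 0 :: 'a) \<in> bcontfun"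
    by (rule bcontfun_normI[where b = 1]) auto
  then show ?thesis by (simp add: unit_seq_def Bcontfun_inverse)
qed

lemma unit_seq_in_c0: "unit_seq i \<in> c0"
proof -
  have "eventually (\<lambda>j. apply_bcontfun (unit_seq i) j = (0::'a)) sequentially"
    using eventually_gt_at_top[of i] by eventually_elim auto
  then show ?thesis by (simp add: c0_def tendsto_eventually)
qed


section \<open>Continuous multilinear forms\<close>

text \<open>
  An \<open>n\<close>-tuple of elements of \<open>c0\<close> is a function in \<open>{..<n} \<rightarrow>\<^sub>E c0\<close>; the values of a form
  outside this set are irrelevant.
\<close>

definition cont_multilinear_forms ::
    "nat \<Rightarrow> ((nat \<Rightarrow> (nat \<Rightarrow>\<^sub>C 'a)) \<Rightarrow> 'a::real_normed_field) set" where
  "cont_multilinear_forms n = {A.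
     (\<forall>x \<in> {..<n} \<rightarrow>\<^sub>E c0. \<forall>j<n.
        (\<forall>y\<in>c0. \<forall>z\<in>c0. A (x(j := y + z)) = A (x(j := y)) + A (x(j := z))) \<and>
        (\<forall>c. \<forall>y\<in>c0. A (x(j := scale_seq c y)) = c * A (x(j := y)))) \<and>
     continuous_map (product_topology (\<lambda>_. top_of_set c0) {..<n}) euclidean A}"

definition form_norm :: "nat \<Rightarrow> ((nat \<Rightarrow> (nat \<Rightarrow>\<^sub>C 'a)) \<Rightarrow> 'a::real_normed_field) \<Rightarrow> ennreal" where
  "form_norm n A = (SUP x \<in> {x \<in> {..<n} \<rightarrow>\<^sub>E c0. \<forall>j<n. norm (x j) \<le> 1}. ennreal (norm (A x)))"

text \<open>The value of \<open>A\<close> at the tuple of unit vectors listed by a multi-index of length \<open>n\<close>.\<close>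

definition form_coeff ::
    "((nat \<Rightarrow> (nat \<Rightarrow>\<^sub>C 'a)) \<Rightarrow> 'a::real_normed_field) \<Rightarrow> nat list \<Rightarrow> 'a" where
  "form_coeff A is = A (\<lambda>j\<in>{..<length is}. unit_seq (is ! j))"


section \<open>Sums of powers in the extended nonnegative reals\<close>

text \<open>Only used with \<open>p > 0\<close>.\<close>

definition ennpowr :: "ennreal \<Rightarrow> real \<Rightarrow> ennreal" where
  "ennpowr x p = (if x = \<infinity> then \<infinity> else ennreal (enn2real x powr p))"

text \<open>
  The iterated sum of mixed exponents \<open>[q\<^sub>1, \<dots>, q\<^sub>n]\<close>, without the outermost power \<open>1 / q\<^sub>1\<close>;
  the argument \<open>f\<close> is evaluated at multi-indices of length \<open>n\<close>.
\<close>

fun mixed_sum :: "real list \<Rightarrow> (nat list \<Rightarrow> real) \<Rightarrow> ennreal" where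
  "mixed_sum [] f = ennreal (f [])"
| "mixed_sum [q] f = (\<Sum>i. ennreal (f [i] powr q))"
| "mixed_sum (q # q' # qs) f =
     (\<Sum>i. ennpowr (mixed_sum (q' # qs) (\<lambda>is. f (i # is))) (q / q'))"


section \<open>Optimal constants\<close>

text \<open>
  The infimum is taken in \<^typ>\<open>ennreal\<close>, so it is \<open>\<infinity>\<close> when no finite constant works.
\<close>

definition mixed_const :: "'a::real_normed_field itself \<Rightarrow> real list \<Rightarrow> ennreal" where
  "mixed_const _ qs = (INF K \<in> {K::real. 0 \<le> K \<and>
     (\<forall>A \<in> (cont_multilinear_forms (length qs) :: ((nat \<Rightarrow> (nat \<Rightarrow>\<^sub>C 'a)) \<Rightarrow> 'a) set).
        ennpowr (mixed_sum qs (\<lambda>is. norm (form_coeff A is))) (1 / hd qs)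
          \<le> ennreal K * form_norm (length qs) A)}. ennreal K)"

definition bohnenblust_hille_const :: "'a::real_normed_field itself \<Rightarrow> nat \<Rightarrow> ennreal" where
  "bohnenblust_hille_const _ m = (INF C \<in> {C::real. 0 \<le> C \<and>
     (\<forall>A \<in> (cont_multilinear_forms m :: ((nat \<Rightarrow> (nat \<Rightarrow>\<^sub>C 'a)) \<Rightarrow> 'a) set).
        ennpowr (\<Sum>\<^sub>\<infinity>is \<in> {is. length is = m}.
                   ennreal (norm (form_coeff A is) powr (2 * m / (m + 1)))) ((m + 1) / (2 * m))
          \<le> ennreal C * form_norm m A)}. ennreal C)"

definition rademacher :: "real measure" where
  "rademacher = measure_pmf (pmf_of_set {-1, 1})"

text \<open>The uniform probability measure on the unit circle.\<close>

definition steinhaus :: "complex measure" where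
  "steinhaus = distr (uniform_measure lborel {0..2 * pi}) borel cis"

text \<open>
  Independent variables with common law \<open>\<mu>\<close> are the coordinates of the product measure. The set
  below contains 0 and is bounded above by 1 when \<open>\<mu>\<close> is one of the two laws above
  (take \<open>N = 1\<close>), so the supremum is a genuine one.
\<close>

definition khinchin_const :: "'a::real_normed_field measure \<Rightarrow> real \<Rightarrow> real" where
  "khinchin_const \<mu> p = Sup {c::real. \<forall>N\<ge>1. \<forall>a :: nat \<Rightarrow> 'a.
     c * (\<Sum>i<N. (norm (a i))\<^sup>2) powr (1 / 2)
       \<le> (\<integral>\<epsilon>. norm (\<Sum>i<N. a i * \<epsilon> i) powr p \<partial>(\<Pi>\<^sub>M i\<in>{..<N}. \<mu>)) powr (1 / p)}"

end

theory Submission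
  imports Defs
begin

text \<open>
  Put \<open>p = 2k/(k+1)\<close>. As \<open>q \<le> 2\<close> for every exponent \<open>q\<close>, Minkowski's inequality allows a
  summation with exponent 2, in any position \<open>t\<close>, to be moved to the innermost place, where Khinchin's
  inequality bounds it by \<open>1 / A_p\<close> times an \<open>L^p\<close> norm over independent signs \<open>\<epsilon>\<close>. As \<open>p \<le> q\<close>,
  Minkowski's inequality then pulls this \<open>L^p\<close> norm outside all the remaining sums. For fixed \<open>\<epsilon>\<close>,
  what is left is the mixed norm of the form in \<open>n - 1\<close> variables obtained by plugging \<open>\<Sum>i<N. \<epsilon>_i e_i\<close>,
  a vector of the unit ball, into variable \<open>t\<close>. After \<open>n - k\<close> such steps all exponents are \<open>p\<close>,
  and the Bohnenblust--Hille inequality applies.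
\<close>

section \<open>Powers in the extended nonnegative reals\<close>

lemma ennpowr_ennreal [simp]: "0 \<le> x \<Longrightarrow> ennpowr (ennreal x) p = ennreal (x powr p)"
  by (simp add: ennpowr_def)

lemma ennpowr_top [simp]: "ennpowr \<infinity> p = \<infinity>" "ennpowr top p = top"
  by (simp_all add: ennpowr_def)

lemma ennpowr_0 [simp]: "ennpowr 0 p = 0"
  by (simp add: ennpowr_def)

lemma ennpowr_1 [simp]: "ennpowr 1 p = 1"
  by (simp add: ennpowr_def)

lemma ennpowr_one [simp]: "ennpowr x 1 = x"
  by (cases x) (auto simp: ennpowr_def)

lemma ennpowr_eq_top_iff [simp]: "ennpowr x p = top \<longleftrightarrow> x = top"
  by (simp add: ennpowr_def)

lemma ennpowr_ennpowr [simp]: "ennpowr (ennpowr x p) q = ennpowr x (p * q)"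
  by (cases x) (auto simp: powr_powr)

lemma ennpowr_mono: "x \<le> y \<Longrightarrow> 0 \<le> p \<Longrightarrow> ennpowr x p \<le> ennpowr y p"
  by (cases x; cases y) (auto simp: top_unique intro!: ennreal_leI powr_mono2)

lemma ennpowr_mult: "0 < p \<Longrightarrow> ennpowr (x * y) p = ennpowr x p * ennpowr y p"
proof (cases x; cases y)
  fix r assume "0 < p" "0 \<le> r" "x = ennreal r" "y = top"
  \<comment> \<open>A zero factor is a case of its own: \<open>0 * top\<close> is 0, whereas a
    positive factor times \<open>top\<close> is \<open>top\<close>.\<close>
  then show ?thesis by (cases "r = 0") (auto simp: ennreal_mult_top)
next
  fix r assume "0 < p" "0 \<le> r" "y = ennreal r" "x = top"
  then show ?thesis by (cases "r = 0") (auto simp: ennreal_top_mult)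
qed (auto simp flip: ennreal_mult simp: powr_mult)

lemma ennpowr_le_iff: "0 < p \<Longrightarrow> ennpowr x p \<le> ennpowr y p \<longleftrightarrow> x \<le> y"
  using ennpowr_mono[of x y p] ennpowr_mono[of "ennpowr x p" "ennpowr y p" "1 / p"] by auto

lemma ennpowr_le_swap:
  assumes "0 < p" shows "ennpowr x (1 / p) \<le> y \<longleftrightarrow> x \<le> ennpowr y p"
  using ennpowr_le_iff[OF assms, of "ennpowr x (1 / p)" y] assms by simp

lemma le_ennpowr_swap:
  assumes "0 < p" shows "x \<le> ennpowr y (1 / p) \<longleftrightarrow> ennpowr x p \<le> y"
  using ennpowr_le_iff[OF assms, of x "ennpowr y (1 / p)"] assms by simp

text \<open>Powers with positive exponent are monotone and have the monotone inverse
  \<open>1 / p\<close>, so they preserve arbitrary suprema.\<close>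

lemma ennpowr_SUP:
  assumes "0 < p" shows "ennpowr (SUP i\<in>I. f i) p = (SUP i\<in>I. ennpowr (f i) p)"
proof (rule antisym)
  have "(SUP i\<in>I. f i) \<le> ennpowr (SUP i\<in>I. ennpowr (f i) p) (1 / p)"
    using assms by (intro SUP_least) (auto simp: le_ennpowr_swap intro: SUP_upper)
  then show "ennpowr (SUP i\<in>I. f i) p \<le> (SUP i\<in>I. ennpowr (f i) p)"
    using assms by (simp add: le_ennpowr_swap)
qed (use assms in \<open>auto intro!: SUP_least ennpowr_mono SUP_upper\<close>)

lemma measurable_ennpowr [measurable (raw)]:
  assumes [measurable]: "f \<in> borel_measurable M"
  shows "(\<lambda>x. ennpowr (f x) p) \<in> borel_measurable M"
proof -
  have "{x \<in> space M. f x = top} = f -` {top} \<inter> space M" by auto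
  then have [measurable]: "{x \<in> space M. f x = top} \<in> sets M" by simp
  show ?thesis unfolding ennpowr_def infinity_ennreal_def by measurable
qed


section \<open>Minkowski's inequality\<close>

text \<open>Young's inequality is summed after both families have been normalized to unit
  \<open>r\<close>-norm. The first factor carries the exponent \<open>r - 1\<close> because this is
  the shape in which the duality proof of Minkowski's inequality uses it.\<close>

lemma Hoelder_sum:
  fixes a b :: "'i \<Rightarrow> real"
  assumes "finite I" "1 \<le> r" and a: "\<And>i. i \<in> I \<Longrightarrow> 0 \<le> a i" and b: "\<And>i. i \<in> I \<Longrightarrow> 0 \<le> b i"
  shows "(\<Sum>i\<in>I. a i powr (r - 1) * b i)
    \<le> (\<Sum>i\<in>I. a i powr r) powr ((r - 1) / r) * (\<Sum>i\<in>I. b i powr r) powr (1 / r)"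
proof (cases "r = 1")
  case True
  \<comment> \<open>For \<open>r = 1\<close> the convention \<open>0 powr 0 = 0\<close> matters: the
    first factor on the right is 0 if all \<open>a i\<close> vanish and 1 otherwise, and on the left
    \<open>a i powr 0\<close> is 0 or 1.\<close>
  show ?thesis
  proof (cases "(\<Sum>i\<in>I. a i) = 0")
    case T: True
    then have "\<forall>i\<in>I. a i = 0" using a assms(1) by (subst (asm) sum_nonneg_eq_0_iff) auto
    then show ?thesis using True by (simp add: sum_nonneg b)
  next
    case False
    have "a i powr 0 * b i \<le> b i" if "i \<in> I" for i using b[OF that] by (cases "a i = 0") auto
    then show ?thesis using True False a b by (auto intro!: sum_mono simp: sum_nonneg)
  qed
next
  case False
  with assms have r: "1 < r" by simp
  define A where "A = (\<Sum>i\<in>I. a i powr r)"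
  define B where "B = (\<Sum>i\<in>I. b i powr r)"
  have nn: "0 \<le> A" "0 \<le> B" by (auto simp: A_def B_def intro: sum_nonneg)
  show ?thesis
  proof (cases "A = 0 \<or> B = 0")
    case True
    then have "\<forall>i\<in>I. a i powr (r - 1) * b i = 0"
      using assms(1) r unfolding A_def B_def by (auto simp: sum_nonneg_eq_0_iff)
    then have "(\<Sum>i\<in>I. a i powr (r - 1) * b i) = 0" by (rule sum.neutral)
    then show ?thesis by simp
  next
    case False
    with nn have pos: "0 < A" "0 < B" by auto
    define \<alpha> where "\<alpha> = A powr (1 / r)"
    define \<beta> where "\<beta> = B powr (1 / r)"
    have \<alpha>: "0 < \<alpha>" "\<alpha> powr r = A" and \<beta>: "0 < \<beta>" "\<beta> powr r = B"
      using pos r by (auto simp: \<alpha>_def \<beta>_def powr_powr)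
    have "(a i / \<alpha>) powr (r - 1) * (b i / \<beta>) \<le> (a i powr r / A) * ((r - 1) / r) + (b i powr r / B) / r"
      if "i \<in> I" for i
    proof -
      have c: "1 / (r / (r - 1)) + 1 / r = 1" "1 < r / (r - 1)"
        using r by (auto simp: field_simps)
      have "(a i / \<alpha>) powr (r - 1) * (b i / \<beta>) \<le> ((a i / \<alpha>) powr (r - 1)) powr (r / (r - 1)) / (r / (r - 1))
          + (b i / \<beta>) powr r / r"
        using c r a[OF that] b[OF that] \<alpha> \<beta> by (intro Youngs_inequality) auto
      then show ?thesis using r a[OF that] b[OF that] \<alpha> \<beta> by (simp add: powr_powr powr_divide)
    qed
    then have "(\<Sum>i\<in>I. (a i / \<alpha>) powr (r - 1) * (b i / \<beta>))
        \<le> (\<Sum>i\<in>I. (a i powr r / A) * ((r - 1) / r) + (b i powr r / B) / r)"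
      by (intro sum_mono)
    also have "\<dots> = (r - 1) / r + 1 / r"
      using pos by (simp add: sum.distrib A_def B_def flip: sum_divide_distrib sum_distrib_right)
    also have "\<dots> = 1" using r by (simp add: field_simps)
    finally have "(\<Sum>i\<in>I. a i powr (r - 1) * b i) / (\<alpha> powr (r - 1) * \<beta>) \<le> 1"
      using \<alpha> \<beta> a by (simp add: powr_divide sum_divide_distrib)
    then have "(\<Sum>i\<in>I. a i powr (r - 1) * b i) \<le> \<alpha> powr (r - 1) * \<beta>"
      using \<alpha> \<beta> by (simp add: divide_le_eq)
    then show ?thesis
      using pos by (simp add: \<alpha>_def \<beta>_def powr_powr A_def B_def)
  qed
qed

text \<open>Duality argument: write \<open>G i\<close> for the integral of \<open>g i\<close> and
  \<open>S\<close> for a partial sum of the \<open>G i powr r\<close>. Then \<open>S\<close> is the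
  integral of the sum of the \<open>G i powr (r - 1) * g i\<close>. Hoelder's inequality under the
  integral bounds it by \<open>S powr ((r - 1) / r)\<close> times the right-hand side, and the power
  of \<open>S\<close> cancels.\<close>

lemma Minkowski_nn_integral:
  assumes r: "1 \<le> r" and g [measurable]: "\<And>i. g i \<in> borel_measurable M"
  shows "ennpowr (\<Sum>i. ennpowr (\<integral>\<^sup>+\<omega>. g i \<omega> \<partial>M) r) (1 / r)
    \<le> (\<integral>\<^sup>+\<omega>. ennpowr (\<Sum>i. ennpowr (g i \<omega>) r) (1 / r) \<partial>M)" (is "_ \<le> ?R")
proof -
  define G where "G i = (\<integral>\<^sup>+\<omega>. g i \<omega> \<partial>M)" for i
  define H where "H \<omega> = ennpowr (\<Sum>i. ennpowr (g i \<omega>) r) (1 / r)" for \<omega>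
  have [measurable]: "H \<in> borel_measurable M" unfolding H_def by measurable
  have gH: "(\<Sum>i<n. ennpowr (g i \<omega>) r) \<le> ennpowr (H \<omega>) r" for n :: nat and \<omega>
    using r unfolding H_def by (simp add: sum_le_suminf)
  have g_le: "g i \<omega> \<le> H \<omega>" for i \<omega>
  proof -
    have "ennpowr (g i \<omega>) r \<le> (\<Sum>i<Suc i. ennpowr (g i \<omega>) r)" by simp
    with gH[where n = "Suc i"] r show ?thesis by (metis ennpowr_le_iff less_le_trans order_trans zero_less_one)
  qed
  \<comment> \<open>Partial sums come first: once the right-hand side is finite, \<open>S\<close> is
    a real number and may be divided out.\<close>
  have main: "(\<Sum>i<n. ennpowr (G i) r) \<le> ennpowr ?R r" for n :: nat
  proof (cases "?R = top")
    case False
    have "G i \<le> ?R" for i unfolding G_def using g_le by (intro nn_integral_mono) (simp add: H_def)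
    with False have "G i \<noteq> top" for i by (metis top.extremum_uniqueI)
    then have "\<exists>x\<ge>0. G i = ennreal x" for i by (cases "G i") auto
    then obtain x where x: "\<And>i. 0 \<le> x i" "\<And>i. G i = ennreal (x i)" by metis
    define S where "S = (\<Sum>i<n. x i powr r)"
    have S0: "0 \<le> S" by (auto simp: S_def intro: sum_nonneg)
    show ?thesis
    proof (cases "S = 0")
      case True
      have "(\<Sum>i<n. ennpowr (G i) r) = ennreal S" by (simp add: S_def x)
      then show ?thesis using True by simp
    next
      case F: False
      with S0 have S: "0 < S" by simp
      have pw: "(\<Sum>i<n. ennreal (x i powr (r - 1)) * g i \<omega>) \<le> ennreal (S powr ((r - 1) / r)) * H \<omega>" for \<omega>
      proof (cases "H \<omega> = top")
        case True then show ?thesis using S by (simp add: ennreal_mult_top)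
      next
        case False
        then have "g i \<omega> \<noteq> top" for i using g_le by (metis top.extremum_uniqueI)
        then have "\<exists>y\<ge>0. g i \<omega> = ennreal y" for i by (cases "g i \<omega>") auto
        then obtain y where y: "\<And>i. 0 \<le> y i" "\<And>i. g i \<omega> = ennreal (y i)" by metis
        have "(\<Sum>i<n. x i powr (r - 1) * y i) \<le> S powr ((r - 1) / r) * (\<Sum>i<n. y i powr r) powr (1 / r)"
          unfolding S_def using r x y by (intro Hoelder_sum) auto
        then have "(\<Sum>i<n. ennreal (x i powr (r - 1)) * g i \<omega>)
            \<le> ennreal (S powr ((r - 1) / r)) * ennpowr (\<Sum>i<n. ennpowr (g i \<omega>) r) (1 / r)"
          using y by (simp add: sum_nonneg flip: ennreal_mult)
        also have "\<dots> \<le> ennreal (S powr ((r - 1) / r)) * H \<omega>"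
          using r gH[where n = n and \<omega> = \<omega>] by (intro mult_left_mono) (simp_all add: ennpowr_le_swap)
        finally show ?thesis .
      qed
      have "x i powr r = x i powr (r - 1) * x i" for i
        using x(1)[of i] r by (simp add: powr_diff)
      then have "ennreal S = (\<Sum>i<n. ennreal (x i powr (r - 1)) * G i)"
        unfolding S_def x using x(1) by (simp flip: ennreal_mult)
      also have "\<dots> = (\<integral>\<^sup>+\<omega>. (\<Sum>i<n. ennreal (x i powr (r - 1)) * g i \<omega>) \<partial>M)"
        unfolding G_def by (simp add: nn_integral_sum nn_integral_cmult)
      also have "\<dots> \<le> (\<integral>\<^sup>+\<omega>. ennreal (S powr ((r - 1) / r)) * H \<omega> \<partial>M)"
        by (intro nn_integral_mono pw)
      also have "\<dots> = ennreal (S powr ((r - 1) / r)) * ?R"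
        by (simp add: nn_integral_cmult H_def)
      finally have *: "ennreal S \<le> ennreal (S powr ((r - 1) / r)) * ?R" .
      obtain z where z: "0 \<le> z" "?R = ennreal z" using False by (cases ?R) auto
      \<comment> \<open>Cancelling \<open>S powr ((r - 1) / r)\<close>, which is positive, leaves
        \<open>S powr (1 / r) \<le> z\<close>.\<close>
      from * z have "S \<le> S powr ((r - 1) / r) * z" by (simp flip: ennreal_mult)
      moreover have "S = S powr ((r - 1) / r) * S powr (1 / r)"
        using S r by (simp flip: powr_add add: field_simps)
      ultimately have "S powr (1 / r) \<le> z" using S
        by (metis mult_le_cancel_left_pos powr_gt_zero less_irrefl)
      then have "(S powr (1 / r)) powr r \<le> z powr r" using r by (intro powr_mono2) auto
      then have "S \<le> z powr r" using S r by (simp add: powr_powr)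
      then show ?thesis unfolding z(2) x(2) using x(1) z(1) by (simp add: S_def)
    qed
  qed simp
  have "(\<Sum>i. ennpowr (G i) r) \<le> ennpowr ?R r"
    by (rule suminf_le_const) (auto simp: main)
  then show ?thesis using r by (simp add: G_def ennpowr_le_swap)
qed

section \<open>Norms with exponents \<open>p\<close> and \<open>q\<close> and Minkowski's inequality
  between them\<close>

definition Lp :: "real \<Rightarrow> 'b measure \<Rightarrow> ('b \<Rightarrow> ennreal) \<Rightarrow> ennreal" where
  "Lp p M f = ennpowr (\<integral>\<^sup>+x. ennpowr (f x) p \<partial>M) (1 / p)"

text \<open>Sums are integrals over the counting measure, so one Minkowski inequality serves both
  for exchanging two summations and for exchanging a summation with an expectation.\<close>

abbreviation lp :: "real \<Rightarrow> (nat \<Rightarrow> ennreal) \<Rightarrow> ennreal" where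
  "lp q \<equiv> Lp q (count_space UNIV)"

lemma lp_suminf: "lp q f = ennpowr (\<Sum>i. ennpowr (f i) q) (1 / q)"
  by (simp add: Lp_def nn_integral_count_space_nat)

lemma Lp_mono: "0 < p \<Longrightarrow> (\<And>x. f x \<le> g x) \<Longrightarrow> Lp p M f \<le> Lp p M g"
  unfolding Lp_def by (intro ennpowr_mono nn_integral_mono) auto

lemma Lp_cmult:
  assumes "0 < p" "f \<in> borel_measurable M"
  shows "Lp p M (\<lambda>x. c * f x) = c * Lp p M f"
  using assms by (simp add: Lp_def ennpowr_mult nn_integral_cmult)

lemma lp_SUP:
  fixes f :: "nat \<Rightarrow> nat \<Rightarrow> ennreal"
  assumes "0 < q" "\<And>i. incseq (\<lambda>N. f N i)"
  shows "lp q (\<lambda>i. SUP N. f N i) = (SUP N. lp q (f N))"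
proof -
  have "incseq (\<lambda>N. ennpowr (f N i) q)" for i
    using assms by (auto simp: incseq_def intro: ennpowr_mono)
  then show ?thesis
    using assms(1) by (simp add: lp_suminf ennpowr_SUP ennreal_suminf_SUP_eq)
qed

lemma measurable_lp [measurable (raw)]:
  assumes [measurable]: "\<And>i. (\<lambda>x. f x i) \<in> borel_measurable M"
  shows "(\<lambda>x. lp q (f x)) \<in> borel_measurable M"
  unfolding lp_suminf by measurable

text \<open>This is the previous inequality for the functions \<open>g i\<close> to the power
  \<open>p\<close>, with \<open>r = q / p \<ge> 1\<close>, followed by a root of order
  \<open>p\<close>.\<close>

lemma Minkowski_lp_Lp:
  assumes pq: "0 < p" "p \<le> q" and g [measurable]: "\<And>i. g i \<in> borel_measurable M"
  shows "lp q (\<lambda>i. Lp p M (g i)) \<le> Lp p M (\<lambda>x. lp q (\<lambda>i. g i x))"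
proof -
  have "ennpowr (\<Sum>i. ennpowr (\<integral>\<^sup>+x. ennpowr (g i x) p \<partial>M) (q / p)) (1 / (q / p))
    \<le> (\<integral>\<^sup>+x. ennpowr (\<Sum>i. ennpowr (ennpowr (g i x) p) (q / p)) (1 / (q / p)) \<partial>M)"
    using pq by (intro Minkowski_nn_integral) (auto simp: field_simps)
  from ennpowr_mono[OF this, of "1 / p"] show ?thesis
    using pq by (simp add: lp_suminf) (simp add: Lp_def)
qed


section \<open>Mixed norms\<close>

text \<open>Unlike in \<open>mixed_sum\<close>, every level takes its own root, so a summation can
  be moved or dropped without changing its neighbours.\<close>

fun mnorm :: "real list \<Rightarrow> (nat list \<Rightarrow> ennreal) \<Rightarrow> ennreal" where
  "mnorm [] f = f []"
| "mnorm (q # qs) f = lp q (\<lambda>i. mnorm qs (\<lambda>is. f (i # is)))"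

text \<open>The exponent \<open>q / q'\<close> of \<open>mixed_sum\<close> combines the root of
  order \<open>q'\<close> of the inner norm with the power \<open>q\<close> of the outer
  one.\<close>

lemma mixed_sum_eq_mnorm_powr:
  assumes "0 < q" "\<And>q. q \<in> set qs \<Longrightarrow> 0 < q" "\<And>is. 0 \<le> f is"
  shows "mixed_sum (q # qs) f = ennpowr (mnorm (q # qs) (\<lambda>is. ennreal (f is))) q"
  using assms
proof (induction qs arbitrary: q f)
  case Nil
  then have "q \<noteq> 0" "\<And>i. 0 \<le> f [i]" by auto
  then show ?case by (simp add: lp_suminf)
next
  case (Cons q' qs)
  have q': "0 < q'" using Cons.prems(2)[of q'] by simp
  have "mixed_sum (q' # qs) (\<lambda>is. f (i # is)) = ennpowr (mnorm (q' # qs) (\<lambda>is. ennreal (f (i # is)))) q'" for i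
    using Cons.prems q' by (intro Cons.IH) simp_all
  then have "mixed_sum (q # q' # qs) f = (\<Sum>i. ennpowr (mnorm (q' # qs) (\<lambda>is. ennreal (f (i # is)))) q)"
    using q' by (simp del: mnorm.simps)
  also have "\<dots> = ennpowr (mnorm (q # q' # qs) (\<lambda>is. ennreal (f is))) q"
    using \<open>0 < q\<close> by (subst mnorm.simps(2)) (simp add: lp_suminf del: mnorm.simps)
  finally show ?case .
qed

lemma mnorm_mono:
  assumes "\<And>q. q \<in> set qs \<Longrightarrow> 0 < q" "\<And>is. length is = length qs \<Longrightarrow> f is \<le> g is"
  shows "mnorm qs f \<le> mnorm qs g"
  using assms
proof (induction qs arbitrary: f g)
  case (Cons q qs)
  show ?case unfolding mnorm.simps
    by (intro Lp_mono Cons.IH) (simp_all add: Cons.prems)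
qed simp

lemma mnorm_cong:
  assumes "\<And>is. length is = length qs \<Longrightarrow> f is = g is"
  shows "mnorm qs f = mnorm qs g"
  using assms
proof (induction qs arbitrary: f g)
  case (Cons q qs)
  have "mnorm qs (\<lambda>is. f (i # is)) = mnorm qs (\<lambda>is. g (i # is))" for i
    by (rule Cons.IH) (simp add: Cons.prems)
  then show ?case unfolding mnorm.simps by (rule arg_cong[OF ext])
qed simp

lemma mnorm_cmult:
  assumes "\<And>q. q \<in> set qs \<Longrightarrow> 0 < q"
  shows "mnorm qs (\<lambda>is. c * f is) = c * mnorm qs f"
  using assms
proof (induction qs arbitrary: f)
  case (Cons q qs)
  have "mnorm qs (\<lambda>is. c * f (i # is)) = c * mnorm qs (\<lambda>is. f (i # is))" for i
    by (rule Cons.IH) (simp add: Cons.prems)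
  then show ?case using Cons.prems[of q] by (simp add: Lp_cmult)
qed simp

text \<open>Monotone convergence, applied at every level of the iterated norm.\<close>

lemma mnorm_SUP:
  fixes f :: "nat \<Rightarrow> nat list \<Rightarrow> ennreal"
  assumes "\<And>q. q \<in> set qs \<Longrightarrow> 0 < q" "\<And>is. incseq (\<lambda>N. f N is)"
  shows "mnorm qs (\<lambda>is. SUP N. f N is) = (SUP N. mnorm qs (f N))"
  using assms
proof (induction qs arbitrary: f)
  case (Cons q qs)
  have "incseq (\<lambda>N. mnorm qs (\<lambda>is. f N (i # is)))" for i
    using Cons.prems by (auto simp: incseq_def intro!: mnorm_mono)
  moreover have "mnorm qs (\<lambda>is. SUP N. f N (i # is)) = (SUP N. mnorm qs (\<lambda>is. f N (i # is)))" for i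
    using Cons.prems by (intro Cons.IH) simp_all
  ultimately show ?case using Cons.prems(1)[of q] by (simp add: lp_SUP)
qed simp

lemma measurable_mnorm:
  assumes "\<And>is. (\<lambda>x. f x is) \<in> borel_measurable M"
  shows "(\<lambda>x. mnorm qs (f x)) \<in> borel_measurable M"
  using assms
proof (induction qs arbitrary: f)
  case (Cons q qs)
  show ?case unfolding mnorm.simps
    by (intro measurable_lp Cons.IH) (simp add: Cons.prems)
qed simp

text \<open>The inner levels let the \<open>Lp\<close> norm through by induction; the outermost one
  then lets it through by Minkowski's inequality, as \<open>p \<le> q\<close>.\<close>

lemma mnorm_Lp_le:
  assumes "0 < p" "\<And>q. q \<in> set qs \<Longrightarrow> p \<le> q" "\<And>is. (\<lambda>x. f x is) \<in> borel_measurable M"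
  shows "mnorm qs (\<lambda>is. Lp p M (\<lambda>x. f x is)) \<le> Lp p M (\<lambda>x. mnorm qs (f x))"
  using assms
proof (induction qs arbitrary: f)
  case (Cons q qs)
  have "p \<le> q" using Cons.prems(2) by simp
  with Cons.prems(1) have "0 < q" by simp
  have "mnorm (q # qs) (\<lambda>is. Lp p M (\<lambda>x. f x is)) \<le> lp q (\<lambda>i. Lp p M (\<lambda>x. mnorm qs (\<lambda>is. f x (i # is))))"
    unfolding mnorm.simps using Cons.prems \<open>0 < q\<close> by (intro Lp_mono Cons.IH) simp_all
  also have "\<dots> \<le> Lp p M (\<lambda>x. mnorm (q # qs) (f x))"
    unfolding mnorm.simps using Cons.prems \<open>p \<le> q\<close>
    by (intro Minkowski_lp_Lp measurable_mnorm) simp_all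
  finally show ?case .
qed simp

text \<open>The summation with the largest exponent \<open>s\<close> is exchanged with its inner
  neighbour by Minkowski's inequality, again and again until it is innermost.\<close>

lemma mnorm_Cons_le:
  assumes "\<And>q. q \<in> set qs \<Longrightarrow> 0 < q \<and> q \<le> s"
  shows "mnorm (s # qs) f \<le> mnorm qs (\<lambda>is. lp s (\<lambda>i. f (i # is)))"
  using assms
proof (induction qs arbitrary: f)
  case (Cons q qs)
  \<comment> \<open>With \<open>j\<close> fixed as second index, \<open>f' j (i # is)\<close> is
    \<open>f (i # j # is)\<close>, so the induction hypothesis carries \<open>s\<close> through the
    remaining levels.\<close>
  define f' where "f' j is = f (hd is # j # tl is)" for j "is"
  have "mnorm (s # q # qs) f \<le> lp q (\<lambda>j. mnorm (s # qs) (f' j))"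
    using Cons.prems Minkowski_lp_Lp[of q s "\<lambda>i j. mnorm qs (\<lambda>is. f (i # j # is))" "count_space UNIV"]
    by (simp add: f'_def)
  also have "\<dots> \<le> lp q (\<lambda>j. mnorm qs (\<lambda>is. lp s (\<lambda>i. f' j (i # is))))"
    using Cons.prems by (intro Lp_mono Cons.IH) simp_all
  finally show ?case by (simp add: f'_def)
qed simp

section \<open>Moving a summation from an arbitrary position to the innermost place\<close>

definition insert_nth :: "nat \<Rightarrow> 'b \<Rightarrow> 'b list \<Rightarrow> 'b list" where
  "insert_nth t y xs = take t xs @ y # drop t xs"

lemma length_insert_nth [simp]: "length (insert_nth t y xs) = Suc (length xs)"
  by (simp add: insert_nth_def min_def)

text \<open>Only the levels of \<open>vs\<close> lie inside that of \<open>s\<close> and are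
  crossed; those of \<open>us\<close> use monotonicity alone.\<close>

lemma mnorm_append_Cons_le:
  assumes "\<And>q. q \<in> set (us @ vs) \<Longrightarrow> 0 < q" "\<And>q. q \<in> set vs \<Longrightarrow> q \<le> s"
  shows "mnorm (us @ s # vs) f \<le> mnorm (us @ vs) (\<lambda>is. lp s (\<lambda>i. f (insert_nth (length us) i is)))"
  using assms
proof (induction us arbitrary: f)
  case Nil
  then show ?case using mnorm_Cons_le[of vs s f] by (simp add: insert_nth_def del: mnorm.simps)
next
  case (Cons u us)
  have "mnorm (us @ s # vs) (\<lambda>is. f (i # is))
    \<le> mnorm (us @ vs) (\<lambda>is. lp s (\<lambda>j. f (i # insert_nth (length us) j is)))" for i
    using Cons.prems by (intro Cons.IH) simp_all
  then show ?case using Cons.prems(1)[of u] by (simp add: Lp_mono insert_nth_def)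
qed

text \<open>Index lists with different heads form disjoint sets, so a partial sum over the head is
  an unordered sum over part of the index set.\<close>

lemma suminf_infsum_Cons_le:
  fixes f :: "nat list \<Rightarrow> ennreal"
  shows "(\<Sum>i. \<Sum>\<^sub>\<infinity>is\<in>{is. length is = n}. f (i # is)) \<le> (\<Sum>\<^sub>\<infinity>is\<in>{is. length is = Suc n}. f is)"
proof -
  let ?L = "{is :: nat list. length is = n}"
  have summ: "f summable_on S" for S by (rule nonneg_summable_on_complete) simp
  have "(\<Sum>i<N. \<Sum>\<^sub>\<infinity>is\<in>?L. f (i # is)) = (\<Sum>\<^sub>\<infinity>is\<in>(\<Union>i<N. (#) i ` ?L). f is)" for N
  proof (induction N)
    case (Suc N)
    have "(\<Sum>\<^sub>\<infinity>is\<in>?L. f (N # is)) = (\<Sum>\<^sub>\<infinity>is\<in>(#) N ` ?L. f is)"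
      by (subst infsum_reindex) (auto simp: comp_def)
    moreover have "(\<Sum>\<^sub>\<infinity>is\<in>(\<Union>i<Suc N. (#) i ` ?L). f is)
        = (\<Sum>\<^sub>\<infinity>is\<in>(\<Union>i<N. (#) i ` ?L). f is) + (\<Sum>\<^sub>\<infinity>is\<in>(#) N ` ?L. f is)"
      unfolding lessThan_Suc UN_insert Un_commute[of "(#) N ` ?L"]
      by (intro infsum_Un_disjoint summ) auto
    ultimately show ?case using Suc by simp
  qed simp
  also have "(\<Sum>\<^sub>\<infinity>is\<in>(\<Union>i<N. (#) i ` ?L). f is) \<le> (\<Sum>\<^sub>\<infinity>is\<in>{is. length is = Suc n}. f is)" for N
    by (rule infsum_mono_neutral[OF summ summ]) auto
  finally show ?thesis by (intro suminf_le_const) auto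
qed

text \<open>With equal exponents the inner roots and outer powers cancel. This connects iterated
  norms with the unordered sum in \<open>bohnenblust_hille_const\<close>.\<close>

lemma mnorm_replicate_le:
  assumes "0 < p"
  shows "mnorm (replicate n p) f
    \<le> ennpowr (\<Sum>\<^sub>\<infinity>is\<in>{is. length is = n}. ennpowr (f is) p) (1 / p)"
proof (induction n arbitrary: f)
  case 0
  then show ?case using assms by simp
next
  case (Suc n)
  have "mnorm (replicate (Suc n) p) f
    \<le> lp p (\<lambda>i. ennpowr (\<Sum>\<^sub>\<infinity>is\<in>{is. length is = n}. ennpowr (f (i # is)) p) (1 / p))"
    using assms Suc by (simp add: Lp_mono)
  also have "\<dots> = ennpowr (\<Sum>i. \<Sum>\<^sub>\<infinity>is\<in>{is. length is = n}. ennpowr (f (i # is)) p) (1 / p)"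
    using assms by (simp add: lp_suminf)
  also have "\<dots> \<le> ennpowr (\<Sum>\<^sub>\<infinity>is\<in>{is. length is = Suc n}. ennpowr (f is) p) (1 / p)"
    using assms by (intro ennpowr_mono suminf_infsum_Cons_le) simp
  finally show ?case .
qed


section \<open>Fixing one variable of a form\<close>

definition insert_var :: "nat \<Rightarrow> 'b \<Rightarrow> (nat \<Rightarrow> 'b) \<Rightarrow> nat \<Rightarrow> 'b" where
  "insert_var t y x j = (if j < t then x j else if j = t then y else x (j - 1))"

lemma insert_var_upd_same: "(insert_var t y x)(t := z) = insert_var t z x"
  by (auto simp: insert_var_def)

text \<open>A variable of the smaller form keeps its position before \<open>t\<close> and moves up
  by one from \<open>t\<close> on; linearity in each variable is transferred through this.\<close>

lemma insert_var_upd: "insert_var t y (x(j := z)) = (insert_var t y x)(if j < t then j else Suc j := z)"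
  by (rule ext) (auto simp: insert_var_def)

lemma insert_var_in:
  assumes "t \<le> n" "y \<in> S" "x \<in> {..<n} \<rightarrow>\<^sub>E S" shows "insert_var t y x \<in> {..<Suc n} \<rightarrow>\<^sub>E S"
proof (rule PiE_I)
  fix j assume "j \<in> {..<Suc n}"
  then show "insert_var t y x j \<in> S"
    using assms by (auto simp: insert_var_def PiE_iff)
next
  fix j assume "j \<notin> {..<Suc n}"
  then show "insert_var t y x j = undefined"
    using assms by (auto simp: insert_var_def PiE_iff extensional_def)
qed

text \<open>For \<open>h = unit_seq\<close> this matches inserting a unit vector into a tuple with
  inserting an index into a multi-index.\<close>

lemma insert_var_nth:
  assumes "t \<le> length is"
  shows "insert_var t (h i) (\<lambda>j\<in>{..<length is}. h (is ! j))
    = (\<lambda>j\<in>{..<Suc (length is)}. h (insert_nth t i is ! j))" (is "?l = ?r")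
proof
  fix j
  consider "j < t" | "j = t" | m where "j = Suc (t + m)"
    by (metis less_imp_Suc_add linorder_neqE_nat)
  then show "?l j = ?r j"
    using assms by cases (auto simp: insert_var_def insert_nth_def nth_append)
qed

lemma form_norm_insert_var:
  fixes y :: "nat \<Rightarrow>\<^sub>C 'a::real_normed_field"
  assumes "t \<le> n" "y \<in> c0" "norm y \<le> 1"
  shows "form_norm n (\<lambda>x. A (insert_var t y x)) \<le> form_norm (Suc n) A"
  unfolding form_norm_def
proof (rule SUP_mono)
  fix x :: "nat \<Rightarrow> nat \<Rightarrow>\<^sub>C 'a"
  assume "x \<in> {x \<in> {..<n} \<rightarrow>\<^sub>E c0. \<forall>j<n. norm (x j) \<le> 1}"
  then have "insert_var t y x \<in> {x \<in> {..<Suc n} \<rightarrow>\<^sub>E c0. \<forall>j<Suc n. norm (x j) \<le> 1}"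
    using assms insert_var_in[of t n y c0 x] by (auto simp: insert_var_def)
  then show "\<exists>z\<in>{x \<in> {..<Suc n} \<rightarrow>\<^sub>E c0. \<forall>j<Suc n. norm (x j) \<le> 1}.
    ennreal (norm (A (insert_var t y x))) \<le> ennreal (norm (A z))" by blast
qed

lemma insert_var_form:
  assumes A: "A \<in> cont_multilinear_forms (Suc n)" and t: "t \<le> n" and y: "y \<in> c0"
  shows "(\<lambda>x. A (insert_var t y x)) \<in> cont_multilinear_forms n"
proof -
  \<comment> \<open>Continuity is checked coordinatewise: every coordinate of
    \<open>insert_var t y\<close> is a projection or the constant \<open>y\<close>.\<close>
  have c: "continuous_map (product_topology (\<lambda>_. top_of_set c0) {..<n})
      (product_topology (\<lambda>_. top_of_set c0) {..<Suc n}) (insert_var t y)"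
    unfolding continuous_map_componentwise
  proof (intro conjI ballI subsetI)
    fix z assume "z \<in> insert_var t y ` topspace (product_topology (\<lambda>_. top_of_set c0) {..<n})"
    then show "z \<in> extensional {..<Suc n}"
      using insert_var_in[OF t y] by (auto simp: PiE_def)
  next
    fix j assume j: "j \<in> {..<Suc n}"
    consider "j < t" | "j = t" | "j > t" by linarith
    then show "continuous_map (product_topology (\<lambda>_. top_of_set c0) {..<n}) (top_of_set c0)
        (\<lambda>x. insert_var t y x j)"
    proof cases
      case 1
      then show ?thesis using t continuous_map_product_projection[of j "{..<n}" "\<lambda>_. top_of_set c0"]
        by (simp add: insert_var_def)
    next
      case 2
      then show ?thesis using y by (simp add: insert_var_def)
    next
      case 3
      then have "j - 1 \<in> {..<n}" using j by auto
      then show ?thesis using 3 continuous_map_product_projection[of "j - 1" "{..<n}" "\<lambda>_. top_of_set c0"]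
        by (simp add: insert_var_def)
    qed
  qed
  have "continuous_map (product_topology (\<lambda>_. top_of_set c0) {..<n}) euclidean (A \<circ> insert_var t y)"
    using A by (intro continuous_map_compose[OF c]) (simp add: cont_multilinear_forms_def)
  moreover have "(if j < t then j else Suc j) < Suc n" if "j < n" for j using that by simp
  ultimately show ?thesis
    using A insert_var_in[OF t y] unfolding cont_multilinear_forms_def
    by (simp add: insert_var_upd comp_def)
qed

section \<open>Finitely supported sequences and the values of a form on them\<close>

lemma zero_in_c0: "0 \<in> c0"
  by (simp add: c0_def zero_bcontfun.rep_eq)

lemma add_in_c0: "x \<in> c0 \<Longrightarrow> y \<in> c0 \<Longrightarrow> x + y \<in> c0"
  by (auto simp: c0_def plus_bcontfun.rep_eq intro: tendsto_eq_intros)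

lemma scale_seq_in_c0: "x \<in> c0 \<Longrightarrow> scale_seq c x \<in> c0"
  using tendsto_mult_right_zero[of "apply_bcontfun x" sequentially c]
  by (simp add: c0_def tendsto_cong[of "apply_bcontfun (scale_seq c x)" "\<lambda>i. c * apply_bcontfun x i"])

definition fin_seq :: "nat \<Rightarrow> (nat \<Rightarrow> 'a) \<Rightarrow> (nat \<Rightarrow>\<^sub>C 'a::real_normed_field)" where
  "fin_seq N \<epsilon> = (\<Sum>i<N. scale_seq (\<epsilon> i) (unit_seq i))"

lemma fin_seq_in_c0: "fin_seq N \<epsilon> \<in> c0"
  unfolding fin_seq_def
  by (induction N) (auto intro: zero_in_c0 add_in_c0 scale_seq_in_c0 unit_seq_in_c0)

lemma apply_fin_seq: "apply_bcontfun (fin_seq N \<epsilon>) j = (if j < N then \<epsilon> j else 0)"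
  unfolding fin_seq_def
  by (induction N) (auto simp: zero_bcontfun.rep_eq plus_bcontfun.rep_eq less_Suc_eq)

lemma norm_fin_seq_le:
  assumes "\<And>i. i < N \<Longrightarrow> norm (\<epsilon> i) \<le> 1" shows "norm (fin_seq N \<epsilon>) \<le> 1"
  using assms by (intro norm_bound) (simp add: apply_fin_seq)

lemma form_fin_seq:
  fixes A :: "(nat \<Rightarrow> (nat \<Rightarrow>\<^sub>C 'a)) \<Rightarrow> 'a::real_normed_field"
  assumes A: "A \<in> cont_multilinear_forms n" and x: "x \<in> {..<n} \<rightarrow>\<^sub>E c0" and j: "j < n"
  shows "A (x(j := fin_seq N \<epsilon>)) = (\<Sum>i<N. \<epsilon> i * A (x(j := unit_seq i)))"
proof -
  have add: "A (x(j := y + z)) = A (x(j := y)) + A (x(j := z))" if "y \<in> c0" "z \<in> c0" for y z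
    using A x j that by (simp add: cont_multilinear_forms_def)
  have scale: "A (x(j := scale_seq c y)) = c * A (x(j := y))" if "y \<in> c0" for c y
    using A x j that by (simp add: cont_multilinear_forms_def)
  show ?thesis
  proof (induction N)
    case 0
    \<comment> \<open>The empty sum is the zero vector, where the form vanishes by homogeneity with
      scalar 0.\<close>
    have "scale_seq 0 0 = (0 :: nat \<Rightarrow>\<^sub>C 'a)" by (rule bcontfun_eqI) (simp add: zero_bcontfun.rep_eq)
    with scale[OF zero_in_c0, of 0] show ?case by (simp add: fin_seq_def del: fun_upd_apply)
  next
    case (Suc N)
    have "A (x(j := fin_seq (Suc N) \<epsilon>)) = A (x(j := fin_seq N \<epsilon>)) + \<epsilon> N * A (x(j := unit_seq N))"
      unfolding fin_seq_def sum.lessThan_Suc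
      by (subst add) (simp_all add: scale fin_seq_in_c0[unfolded fin_seq_def] scale_seq_in_c0 unit_seq_in_c0)
    with Suc show ?case by (simp del: fun_upd_apply)
  qed
qed

text \<open>Plugging \<open>fin_seq N \<epsilon>\<close> into variable \<open>t\<close> turns
  coefficients into exactly the random sums that Khinchin's inequality bounds.\<close>

lemma form_coeff_insert_var:
  assumes A: "A \<in> cont_multilinear_forms (Suc (length is))" and t: "t \<le> length is"
  shows "form_coeff (\<lambda>x. A (insert_var t (fin_seq N \<epsilon>) x)) is
    = (\<Sum>i<N. form_coeff A (insert_nth t i is) * \<epsilon> i)"
proof -
  define x where "x = (\<lambda>j\<in>{..<length is}. unit_seq (is ! j) :: nat \<Rightarrow>\<^sub>C 'a)"
  \<comment> \<open>The 0 at position \<open>t\<close> is a placeholder, overwritten by the updates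
    in \<open>form_fin_seq\<close>.\<close>
  have x: "insert_var t 0 x \<in> {..<Suc (length is)} \<rightarrow>\<^sub>E c0"
    using t by (intro insert_var_in) (auto simp: x_def zero_in_c0 unit_seq_in_c0)
  show ?thesis
    using form_fin_seq[OF A x, of t N \<epsilon>] t
    by (simp add: insert_var_upd_same form_coeff_def insert_var_nth mult.commute flip: x_def)
       (simp add: x_def insert_var_nth)
qed


section \<open>Khinchin's inequality for mixed norms\<close>

text \<open>Khinchin's inequality concerns finite sums; monotone convergence later recovers the full
  square sum from these truncations.\<close>

lemma lp_2_eq_SUP:
  "lp 2 (\<lambda>i. ennreal (norm (b i))) = (SUP N. ennreal ((\<Sum>i<N. (norm (b i))\<^sup>2) powr (1 / 2)))"
proof -
  have "(\<Sum>i. ennreal ((norm (b i))\<^sup>2)) = (SUP N. ennreal (\<Sum>i<N. (norm (b i))\<^sup>2))"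
    by (simp add: suminf_eq_SUP)
  then show ?thesis
    by (simp add: lp_suminf ennpowr_SUP sum_nonneg)
qed

text \<open>The supremum is itself admissible: where the square sum is positive, every admissible
  \<open>c\<close> is at most \<open>?Y / ?X\<close>, hence so is the supremum.\<close>

lemma khinchin_const_le:
  fixes \<mu> :: "'a::real_normed_field measure" and a :: "nat \<Rightarrow> 'a"
  assumes "1 \<le> N"
  shows "khinchin_const \<mu> p * (\<Sum>i<N. (norm (a i))\<^sup>2) powr (1 / 2)
    \<le> (\<integral>\<epsilon>. norm (\<Sum>i<N. a i * \<epsilon> i) powr p \<partial>(\<Pi>\<^sub>M i\<in>{..<N}. \<mu>)) powr (1 / p)"
    (is "_ * ?X \<le> ?Y")
proof (cases "?X = 0")
  case False
  then have X: "0 < ?X" by (simp add: sum_nonneg less_le)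
  define S where "S = {c::real. \<forall>N\<ge>1. \<forall>a :: nat \<Rightarrow> 'a. c * (\<Sum>i<N. (norm (a i))\<^sup>2) powr (1 / 2)
    \<le> (\<integral>\<epsilon>. norm (\<Sum>i<N. a i * \<epsilon> i) powr p \<partial>(\<Pi>\<^sub>M i\<in>{..<N}. \<mu>)) powr (1 / p)}"
  have "0 \<in> S" by (simp add: S_def)
  moreover have "c \<le> ?Y / ?X" if "c \<in> S" for c
  proof -
    have "c * ?X \<le> ?Y" using that assms unfolding S_def by blast
    then show ?thesis using X by (simp add: pos_le_divide_eq)
  qed
  ultimately have "Sup S \<le> ?Y / ?X" by (intro cSup_least) auto
  then show ?thesis using X by (simp add: pos_le_divide_eq khinchin_const_def S_def)
qed simp

text \<open>Treats the Rademacher and Steinhaus laws together. The almost sure bound puts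
  \<open>fin_seq N \<epsilon>\<close> into the unit ball. Measurability is asked of the identity
  because all sets are measurable for \<open>rademacher\<close>, but only the Borel sets for
  \<open>steinhaus\<close>.\<close>

locale bounded_law = prob_space \<mu> for \<mu> :: "'a::{real_normed_field, second_countable_topology} measure" +
  assumes borel: "(\<lambda>x. x) \<in> borel_measurable \<mu>" and AE_norm_le: "AE x in \<mu>. norm x \<le> 1"
begin

abbreviation P :: "nat \<Rightarrow> (nat \<Rightarrow> 'a) measure" where
  "P N \<equiv> \<Pi>\<^sub>M i\<in>{..<N}. \<mu>"

lemma prob_space_P: "prob_space (P N)"
  by (intro prob_space_PiM prob_space_axioms)

lemma AE_P: "AE \<epsilon> in P N. \<forall>i\<in>{..<N}. norm (\<epsilon> i) \<le> 1"
  by (intro AE_finite_allI AE_PiM_component prob_space_axioms AE_norm_le) auto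

lemma measurable_coord: "i < N \<Longrightarrow> (\<lambda>\<epsilon>. \<epsilon> i) \<in> borel_measurable (P N)"
  using measurable_compose[OF measurable_component_singleton[of i "{..<N}" "\<lambda>_. \<mu>"] borel] by simp

lemma measurable_norm_sum_P: "(\<lambda>\<epsilon>. norm (\<Sum>i<N. a i * \<epsilon> i)) \<in> borel_measurable (P N)"
  by (intro measurable_compose[OF _ borel_measurable_norm] borel_measurable_sum borel_measurable_times
      borel_measurable_const measurable_coord) simp

lemma khinchin_Lp:
  assumes "0 < p"
  shows "ennreal (khinchin_const \<mu> p) * ennreal ((\<Sum>i<N. (norm (a i))\<^sup>2) powr (1 / 2))
    \<le> Lp p (P N) (\<lambda>\<epsilon>. ennreal (norm (\<Sum>i<N. a i * \<epsilon> i)))"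
\<comment> \<open>The Khinchin constant speaks of \<open>N \<ge> 1\<close>; for \<open>N = 0\<close>
  the left-hand side is 0.\<close>
proof (cases "N = 0")
  case False
  let ?I = "\<integral>\<epsilon>. norm (\<Sum>i<N. a i * \<epsilon> i) powr p \<partial>P N"
  \<comment> \<open>As \<open>enn2real top = 0\<close>, the real integral is at most the extended
    one without any check of integrability.\<close>
  have le: "ennreal (enn2real x) \<le> x" for x by (cases x) auto
  have "?I = enn2real (\<integral>\<^sup>+\<epsilon>. ennreal (norm (\<Sum>i<N. a i * \<epsilon> i) powr p) \<partial>P N)"
    by (intro integral_eq_nn_integral powr_real_measurable measurable_norm_sum_P
        borel_measurable_const AE_I2) simp
  then have "ennreal ?I \<le> (\<integral>\<^sup>+\<epsilon>. ennreal (norm (\<Sum>i<N. a i * \<epsilon> i) powr p) \<partial>P N)"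
    by (simp only: le)
  then have I: "ennpowr (ennreal ?I) (1 / p) \<le> Lp p (P N) (\<lambda>\<epsilon>. ennreal (norm (\<Sum>i<N. a i * \<epsilon> i)))"
    using assms unfolding Lp_def by (intro ennpowr_mono) auto
  have "ennreal (khinchin_const \<mu> p) * ennreal ((\<Sum>i<N. (norm (a i))\<^sup>2) powr (1 / 2))
      = ennreal (khinchin_const \<mu> p * (\<Sum>i<N. (norm (a i))\<^sup>2) powr (1 / 2))"
    by (rule ennreal_mult''[symmetric]) simp
  also have "\<dots> \<le> ennreal (?I powr (1 / p))"
    using False by (intro ennreal_leI khinchin_const_le) simp
  also have "\<dots> = ennpowr (ennreal ?I) (1 / p)"
    by (rule ennpowr_ennreal[symmetric]) simp
  also note I
  finally show ?thesis .
qed simp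

text \<open>One reduction step, removing an exponent 2 at the cost of one Khinchin factor. The bound
  \<open>B\<close> must be uniform over the unit ball, because the plugged-in vector is
  random.\<close>

lemma khinchin_mnorm:
  fixes A :: "(nat \<Rightarrow> (nat \<Rightarrow>\<^sub>C 'a)) \<Rightarrow> 'a"
  assumes A: "A \<in> cont_multilinear_forms (Suc (length (us @ vs)))"
    and p: "0 < p" "\<And>q. q \<in> set (us @ vs) \<Longrightarrow> p \<le> q" "\<And>q. q \<in> set vs \<Longrightarrow> q \<le> 2"
    and B: "\<And>y. y \<in> c0 \<Longrightarrow> norm y \<le> 1 \<Longrightarrow>
      mnorm (us @ vs) (\<lambda>is. norm (form_coeff (\<lambda>x. A (insert_var (length us) y x)) is)) \<le> B"
  shows "ennreal (khinchin_const \<mu> p) * mnorm (us @ 2 # vs) (\<lambda>is. norm (form_coeff A is)) \<le> B"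
proof -
  let ?A = "ennreal (khinchin_const \<mu> p)"
  have pos: "0 < q" if "q \<in> set (us @ vs)" for q using p(1) p(2)[OF that] by simp
  define a where "a is i = form_coeff A (insert_nth (length us) i is)" for "is" i
  define s where "s N is = ennreal ((\<Sum>i<N. (norm (a is i))\<^sup>2) powr (1 / 2))" for N "is"
  define g :: "nat \<Rightarrow> (nat \<Rightarrow> 'a) \<Rightarrow> nat list \<Rightarrow> ennreal"
    where "g N \<epsilon> is = ennreal (norm (\<Sum>i<N. a is i * \<epsilon> i))" for N \<epsilon> "is"
  have inc: "incseq (\<lambda>N. s N is)" for "is"
    unfolding s_def incseq_def
    by (intro allI impI ennreal_leI powr_mono2 sum_mono2) (auto simp: sum_nonneg)
  \<comment> \<open>For fixed \<open>N\<close>: Khinchin for each multi-index, then Minkowski to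
    pull the expectation out, then the uniform bound \<open>B\<close> for almost every
    \<open>\<epsilon>\<close>.\<close>
  have fin: "?A * mnorm (us @ vs) (s N) \<le> B" for N
  proof -
    interpret P: prob_space "P N" by (rule prob_space_P)
    have gm: "(\<lambda>\<epsilon>. g N \<epsilon> is) \<in> borel_measurable (P N)" for "is"
      unfolding g_def by (rule measurable_compose[OF measurable_norm_sum_P measurable_ennreal])
    have "?A * mnorm (us @ vs) (s N) = mnorm (us @ vs) (\<lambda>is. ?A * s N is)"
      using pos by (rule mnorm_cmult[symmetric])
    also have "\<dots> \<le> mnorm (us @ vs) (\<lambda>is. Lp p (P N) (\<lambda>\<epsilon>. g N \<epsilon> is))"
      unfolding s_def g_def using pos by (intro mnorm_mono khinchin_Lp p)
    also have "\<dots> \<le> Lp p (P N) (\<lambda>\<epsilon>. mnorm (us @ vs) (g N \<epsilon>))"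
      using p(1,2) gm by (rule mnorm_Lp_le)
    also have "\<dots> \<le> ennpowr (\<integral>\<^sup>+\<epsilon>. ennpowr B p \<partial>P N) (1 / p)"
      unfolding Lp_def
    proof (intro ennpowr_mono nn_integral_mono_AE)
      show "AE \<epsilon> in P N. ennpowr (mnorm (us @ vs) (g N \<epsilon>)) p \<le> ennpowr B p"
        using AE_P[of N]
      proof eventually_elim
        case (elim \<epsilon>)
        have "mnorm (us @ vs) (g N \<epsilon>)
          = mnorm (us @ vs) (\<lambda>is. norm (form_coeff (\<lambda>x. A (insert_var (length us) (fin_seq N \<epsilon>) x)) is))"
          using A by (intro mnorm_cong) (simp add: g_def a_def form_coeff_insert_var)
        also have "\<dots> \<le> B"
          using elim by (intro B fin_seq_in_c0 norm_fin_seq_le) auto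
        finally show ?case using p(1) by (simp add: ennpowr_mono)
      qed
    qed (use p(1) in simp)
    \<comment> \<open>On a probability space the \<open>Lp\<close> norm of a constant is that
      constant.\<close>
    also have "\<dots> = B" using p(1) by (simp add: P.emeasure_space_1)
    finally show ?thesis .
  qed
  have "mnorm (us @ 2 # vs) (\<lambda>is. norm (form_coeff A is))
    \<le> mnorm (us @ vs) (\<lambda>is. lp 2 (\<lambda>i. norm (form_coeff A (insert_nth (length us) i is))))"
    using pos p(3) by (rule mnorm_append_Cons_le)
  also have "\<dots> = mnorm (us @ vs) (\<lambda>is. SUP N. s N is)"
    by (simp add: lp_2_eq_SUP s_def a_def)
  also have "\<dots> = (SUP N. mnorm (us @ vs) (s N))"
    using pos inc by (rule mnorm_SUP)
  finally have "?A * mnorm (us @ 2 # vs) (\<lambda>is. norm (form_coeff A is)) \<le> ?A * (SUP N. mnorm (us @ vs) (s N))"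
    by (rule mult_left_mono) simp
  also have "\<dots> \<le> B"
    unfolding SUP_mult_left_ennreal using fin by (rule SUP_least)
  finally show ?thesis .
qed

text \<open>
  The Khinchin constant stays on the left-hand side because its positivity is never proved: if it
  were 0, the bound of the theorem would be \<open>\<infinity>\<close>, as Bohnenblust--Hille constants are at least 1.
\<close>

lemma khinchin_power_mnorm:
  fixes A :: "(nat \<Rightarrow> (nat \<Rightarrow>\<^sub>C 'a)) \<Rightarrow> 'a"
  assumes p: "0 < p" "p < 2"
    and base: "\<And>A :: (nat \<Rightarrow> (nat \<Rightarrow>\<^sub>C 'a)) \<Rightarrow> 'a. A \<in> cont_multilinear_forms k \<Longrightarrow>
      mnorm (replicate k p) (\<lambda>is. norm (form_coeff A is)) \<le> C * form_norm k A"
    and A: "A \<in> cont_multilinear_forms (k + m)"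
    and "length qs = k + m" "length (filter ((=) p) qs) = k" "set qs \<subseteq> {p, 2}"
  shows "ennreal (khinchin_const \<mu> p) ^ m * mnorm qs (\<lambda>is. norm (form_coeff A is)) \<le> C * form_norm (k + m) A"
  using assms(4-)
proof (induction m arbitrary: qs A)
  case 0
  then have "filter ((=) p) qs = qs" 
    by (metis add_0_right filter_True length_filter_less less_irrefl)
  then have "qs = replicate k p"
    using 0 by (intro replicate_eqI) (auto simp: filter_id_conv)
  then show ?case using base 0 by simp
next
  case (Suc m)
  \<comment> \<open>Pigeonhole: only \<open>k\<close> of the \<open>k + Suc m\<close> exponents
    equal \<open>p\<close>.\<close>
  have "2 \<in> set qs"
  proof (rule ccontr)
    assume "2 \<notin> set qs"
    then have "filter ((=) p) qs = qs" using Suc.prems(4) by (subst filter_id_conv) auto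
    then show False using Suc.prems(2,3) by simp
  qed
  then obtain us vs where qs: "qs = us @ 2 # vs" by (meson split_list)
  have len: "length (us @ vs) = k + m" using Suc.prems(2) qs by simp
  \<comment> \<open>Since \<open>p < 2\<close>, dropping an entry 2 does not change the number of
    entries \<open>p\<close>.\<close>
  have filter: "length (filter ((=) p) (us @ vs)) = k" using Suc.prems(3) p qs by simp
  have set: "set (us @ vs) \<subseteq> {p, 2}" using Suc.prems(4) unfolding qs by auto
  then have bounds: "p \<le> q" "q \<le> 2" if "q \<in> set (us @ vs)" for q using that p by fastforce+
  let ?\<kappa> = "ennreal (khinchin_const \<mu> p)"
  let ?N = "\<lambda>y. mnorm (us @ vs) (\<lambda>is. norm (form_coeff (\<lambda>x. A (insert_var (length us) y x)) is))"
  let ?Y = "{y \<in> c0. norm y \<le> 1}"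
  have A: "A \<in> cont_multilinear_forms (Suc (k + m))" using Suc.prems(1) by simp
  \<comment> \<open>The bound \<open>B\<close> is taken as the supremum over the unit ball; the
    remaining Khinchin factors can be moved inside it, and the induction hypothesis applies to each
    \<open>y\<close>.\<close>
  have "?\<kappa> * mnorm qs (\<lambda>is. norm (form_coeff A is)) \<le> (SUP y\<in>?Y. ?N y)"
    unfolding qs
  proof (rule khinchin_mnorm[OF _ p(1)])
    show "A \<in> cont_multilinear_forms (Suc (length (us @ vs)))" using A len by simp
    show "p \<le> q" if "q \<in> set (us @ vs)" for q using that by (rule bounds)
    show "q \<le> 2" if "q \<in> set vs" for q using that bounds(2)[of q] by simp
    show "?N y \<le> (SUP y\<in>?Y. ?N y)" if "y \<in> c0" "norm y \<le> 1" for y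
      using that by (intro SUP_upper) auto
  qed
  then have "?\<kappa> ^ m * (?\<kappa> * mnorm qs (\<lambda>is. norm (form_coeff A is))) \<le> ?\<kappa> ^ m * (SUP y\<in>?Y. ?N y)"
    by (rule mult_left_mono) simp
  also have "\<dots> \<le> C * form_norm (k + Suc m) A"
    unfolding SUP_mult_left_ennreal
  proof (rule SUP_least)
    fix y :: "nat \<Rightarrow>\<^sub>C 'a" assume y: "y \<in> ?Y"
    have t: "length us \<le> k + m" using len by simp
    have "?\<kappa> ^ m * ?N y \<le> C * form_norm (k + m) (\<lambda>x. A (insert_var (length us) y x))"
      using y by (intro Suc.IH insert_var_form A t len filter set) simp
    also have "\<dots> \<le> C * form_norm (Suc (k + m)) A"
      using y t by (intro mult_left_mono form_norm_insert_var) auto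
    finally show "?\<kappa> ^ m * ?N y \<le> C * form_norm (k + Suc m) A" by simp
  qed
  finally show ?case by (simp add: ac_simps)
qed

end


section \<open>Comparison of the constants\<close>

lemma continuous_on_eval: "continuous_on S (\<lambda>y :: nat \<Rightarrow>\<^sub>C 'a::real_normed_field. apply_bcontfun y i)"
  unfolding continuous_on_iff
  by (meson dist_bounded order.strict_trans1)

text \<open>The product of the first coordinates: a form of norm at most 1 whose coefficient at the
  multi-index of zeros is 1.\<close>

definition eval_form :: "nat \<Rightarrow> (nat \<Rightarrow> (nat \<Rightarrow>\<^sub>C 'a)) \<Rightarrow> 'a::real_normed_field" where
  "eval_form n x = (\<Prod>j<n. apply_bcontfun (x j) 0)"

lemma eval_form_in: "eval_form n \<in> cont_multilinear_forms n"
proof -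
  have upd: "eval_form n (x(j := y)) = apply_bcontfun y 0 * (\<Prod>i\<in>{..<n} - {j}. apply_bcontfun (x i) 0)"
    if "j < n" for x j and y :: "nat \<Rightarrow>\<^sub>C 'a"
    using that unfolding eval_form_def by (subst prod.remove[of _ j]) auto
  have "continuous_map (product_topology (\<lambda>_. top_of_set c0) {..<n}) euclidean (\<lambda>x. apply_bcontfun (x j) (0::nat) :: 'a)"
    if "j < n" for j
  proof -
    have "continuous_map (product_topology (\<lambda>_. top_of_set c0) {..<n}) euclidean
        ((\<lambda>y. apply_bcontfun y 0 :: 'a) \<circ> (\<lambda>x. x j))"
      using that by (intro continuous_map_compose[OF continuous_map_product_projection])
        (auto simp: continuous_on_eval)
    then show ?thesis by (simp add: comp_def)
  qed
  then have "continuous_map (product_topology (\<lambda>_. top_of_set c0) {..<n}) euclidean (eval_form n :: _ \<Rightarrow> 'a)"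
    unfolding continuous_map_atin eval_form_def by (auto intro!: tendsto_prod)
  then show ?thesis
    unfolding cont_multilinear_forms_def
    by (simp add: upd plus_bcontfun.rep_eq distrib_right mult.assoc del: fun_upd_apply)
qed

lemma form_norm_eval_form_le: "form_norm n (eval_form n :: _ \<Rightarrow> 'a::real_normed_field) \<le> 1"
  unfolding form_norm_def
proof (rule SUP_least)
  fix x :: "nat \<Rightarrow> nat \<Rightarrow>\<^sub>C 'a"
  assume "x \<in> {x \<in> {..<n} \<rightarrow>\<^sub>E c0. \<forall>j<n. norm (x j) \<le> 1}"
  then have "norm (apply_bcontfun (x j) 0) \<le> 1" if "j < n" for j
    using that norm_bounded[of "x j" 0] by force
  then have "(\<Prod>j<n. norm (apply_bcontfun (x j) 0)) \<le> 1"
    by (intro prod_le_1) auto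
  then show "ennreal (norm (eval_form n x)) \<le> 1"
    by (simp add: eval_form_def prod_norm ennreal_le_1)
qed

lemma bohnenblust_hille_const_ge_1:
  assumes "1 \<le> m"
  shows "1 \<le> bohnenblust_hille_const TYPE('a::real_normed_field) m"
  unfolding bohnenblust_hille_const_def
proof (rule INF_greatest, clarify)
  let ?q = "2 * real m / (real m + 1)"
  let ?f = "\<lambda>is. ennreal (norm (form_coeff (eval_form m :: _ \<Rightarrow> 'a) is) powr ?q)"
  fix C :: real
  assume C: "0 \<le> C" and *: "\<forall>A\<in>cont_multilinear_forms m :: ((nat \<Rightarrow> (nat \<Rightarrow>\<^sub>C 'a)) \<Rightarrow> 'a) set.
    ennpowr (\<Sum>\<^sub>\<infinity>is | length is = m. ennreal (norm (form_coeff A is) powr (2 * real m / (real m + 1)))) ((real m + 1) / (2 * real m))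
      \<le> ennreal C * form_norm m A"
  have "?f (replicate m 0) = 1"
    by (simp add: form_coeff_def eval_form_def)
  then have "1 = (\<Sum>\<^sub>\<infinity>is\<in>{replicate m 0}. ?f is)" by simp
  also have "\<dots> \<le> (\<Sum>\<^sub>\<infinity>is | length is = m. ?f is)"
    by (rule infsum_mono_neutral) (auto intro!: nonneg_summable_on_complete)
  finally have "ennpowr 1 ((real m + 1) / (2 * real m))
      \<le> ennpowr (\<Sum>\<^sub>\<infinity>is | length is = m. ?f is) ((real m + 1) / (2 * real m))"
    by (rule ennpowr_mono) simp
  also have "\<dots> \<le> ennreal C * form_norm m (eval_form m :: _ \<Rightarrow> 'a)"
    by (rule bspec[OF * eval_form_in])
  also have "\<dots> \<le> ennreal C * 1"
    by (intro mult_left_mono form_norm_eval_form_le) simp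
  finally show "1 \<le> ennreal C" by simp
qed

text \<open>The reduction gives the bound with the Khinchin factors on the left; what remains is to
  divide by them in \<open>ennreal\<close> and to pass to the infima defining both
  constants.\<close>

lemma (in bounded_law) mixed_const_le:
  assumes k: "1 \<le> k" "k \<le> n" and len: "length qs = n"
    and card: "card {j. j < n \<and> qs ! j = 2 * real k / (real k + 1)} = k"
    and two: "\<forall>j<n. qs ! j \<noteq> 2 * real k / (real k + 1) \<longrightarrow> qs ! j = 2"
  shows "mixed_const TYPE('a) qs \<le> bohnenblust_hille_const TYPE('a) k
    * inverse (ennreal (khinchin_const \<mu> (2 * real k / (real k + 1)))) ^ (n - k)"
proof -
  define p where "p = 2 * real k / (real k + 1)"
  define \<kappa> where "\<kappa> = ennreal (khinchin_const \<mu> p)"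
  have p: "0 < p" "p < 2" and p_inv: "1 / p = (real k + 1) / (2 * real k)"
    using k by (auto simp: p_def field_simps)
  have filter: "length (filter ((=) p) qs) = k"
    using card len by (simp add: length_filter_conv_card p_def eq_commute)
  have set: "set qs \<subseteq> {p, 2}"
    using two len by (auto simp: in_set_conv_nth p_def)
  show ?thesis
  \<comment> \<open>If a vanishing Khinchin constant is really inverted, the right-hand side is
    \<open>top\<close>, as the Bohnenblust--Hille constant is not 0. For \<open>k = n\<close> the
    power is 1 whatever \<open>\<kappa>\<close> is.\<close>
  proof (cases "\<kappa> = 0 \<and> k < n")
    case True
    then have "inverse \<kappa> ^ (n - k) = top" by (simp add: power_top_ennreal)
    moreover have "bohnenblust_hille_const TYPE('a) k \<noteq> 0"
      using bohnenblust_hille_const_ge_1[OF k(1), where 'a = 'a] by auto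
    ultimately show ?thesis by (simp add: \<kappa>_def p_def ennreal_mult_top)
  next
    case False
    \<comment> \<open>The infimum in \<open>mixed_const\<close> runs over real constants, so the
      inverse is needed as a real number, to form the candidate \<open>C * x\<close>.\<close>
    define x where "x = inverse (khinchin_const \<mu> p) ^ (n - k)"
    have inv: "inverse \<kappa> ^ (n - k) = ennreal x" "ennreal x * \<kappa> ^ (n - k) = 1" "0 \<le> x"
    proof -
      have "inverse \<kappa> ^ (n - k) = ennreal x \<and> ennreal x * \<kappa> ^ (n - k) = 1 \<and> 0 \<le> x"
      proof (cases "k < n")
        case True
        with False have "0 < khinchin_const \<mu> p" unfolding \<kappa>_def by (simp add: ennreal_eq_0_iff)
        then show ?thesis
          by (simp add: \<kappa>_def x_def inverse_ennreal ennreal_power flip: ennreal_mult power_mult_distrib)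
      qed (simp add: x_def)
      then show "inverse \<kappa> ^ (n - k) = ennreal x" "ennreal x * \<kappa> ^ (n - k) = 1" "0 \<le> x" by auto
    qed
    \<comment> \<open>With \<open>\<kappa>\<close> on the left, the right-hand side is a bare
      infimum and a single admissible \<open>C\<close> can be treated at a time; multiplying by
      \<open>x\<close> afterwards undoes this.\<close>
    have "mixed_const TYPE('a) qs * \<kappa> ^ (n - k) \<le> bohnenblust_hille_const TYPE('a) k"
      unfolding bohnenblust_hille_const_def
    proof (rule INF_greatest, clarify)
      fix C :: real
      assume C: "0 \<le> C" and *: "\<forall>A\<in>cont_multilinear_forms k :: ((nat \<Rightarrow> (nat \<Rightarrow>\<^sub>C 'a)) \<Rightarrow> 'a) set.
        ennpowr (\<Sum>\<^sub>\<infinity>is | length is = k. ennreal (norm (form_coeff A is) powr (2 * real k / (real k + 1)))) ((real k + 1) / (2 * real k))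
          \<le> ennreal C * form_norm k A"
      have base: "mnorm (replicate k p) (\<lambda>is. norm (form_coeff A is)) \<le> ennreal C * form_norm k A"
        if "A \<in> cont_multilinear_forms k" for A :: "(nat \<Rightarrow> (nat \<Rightarrow>\<^sub>C 'a)) \<Rightarrow> 'a"
      proof -
        have "mnorm (replicate k p) (\<lambda>is. norm (form_coeff A is))
          \<le> ennpowr (\<Sum>\<^sub>\<infinity>is | length is = k. ennreal (norm (form_coeff A is) powr p)) (1 / p)"
          using mnorm_replicate_le[OF p(1), of k "\<lambda>is. norm (form_coeff A is)"] by simp
        also have "\<dots> \<le> ennreal C * form_norm k A"
          using bspec[OF * that] by (simp add: p_inv flip: p_def)
        finally show ?thesis .
      qed
      have "ennpowr (mixed_sum qs (\<lambda>is. norm (form_coeff A is))) (1 / hd qs) \<le> ennreal (C * x) * form_norm (length qs) A"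
        if A: "A \<in> cont_multilinear_forms (length qs)" for A :: "(nat \<Rightarrow> (nat \<Rightarrow>\<^sub>C 'a)) \<Rightarrow> 'a"
      proof -
        have pos: "0 < q" if "q \<in> set qs" for q using subsetD[OF set that] p by auto
        obtain q qs' where qs: "qs = q # qs'" using k len by (cases qs) auto
        have "ennpowr (mixed_sum qs (\<lambda>is. norm (form_coeff A is))) (1 / hd qs)
          = mnorm qs (\<lambda>is. norm (form_coeff A is))"
        proof -
          have q: "0 < q" by (rule pos) (simp add: qs)
          have "mixed_sum (q # qs') (\<lambda>is. norm (form_coeff A is))
            = ennpowr (mnorm (q # qs') (\<lambda>is. norm (form_coeff A is))) q"
            by (rule mixed_sum_eq_mnorm_powr[OF q pos]) (simp_all add: qs)
          with q show ?thesis by (simp add: qs del: mnorm.simps)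
        qed
        also have "\<dots> = ennreal x * (\<kappa> ^ (n - k) * mnorm qs (\<lambda>is. norm (form_coeff A is)))"
          using inv(2) by (simp flip: mult.assoc)
        also have "ennreal x * (\<kappa> ^ (n - k) * mnorm qs (\<lambda>is. norm (form_coeff A is)))
            \<le> ennreal x * (ennreal C * form_norm (k + (n - k)) A)"
          unfolding \<kappa>_def
          by (rule mult_left_mono, rule khinchin_power_mnorm[OF p base]) (use A k len filter set in simp_all)
        also have "ennreal x * (ennreal C * form_norm (k + (n - k)) A) = ennreal (C * x) * form_norm (length qs) A"
          using k len C inv(3) by (simp add: ennreal_mult ac_simps)
        finally show ?thesis .
      qed
      then have "mixed_const TYPE('a) qs \<le> ennreal (C * x)"
        unfolding mixed_const_def using C inv(3) by (intro INF_lower) auto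
      then have "mixed_const TYPE('a) qs * \<kappa> ^ (n - k) \<le> ennreal (C * x) * \<kappa> ^ (n - k)"
        by (rule mult_right_mono) simp
      also have "\<dots> = ennreal C"
        using inv C by (simp add: ennreal_mult mult.assoc)
      finally show "mixed_const TYPE('a) qs * \<kappa> ^ (n - k) \<le> ennreal C" .
    qed
    then have "mixed_const TYPE('a) qs * \<kappa> ^ (n - k) * ennreal x \<le> bohnenblust_hille_const TYPE('a) k * ennreal x"
      by (rule mult_right_mono) simp
    then show ?thesis
      using inv by (simp add: mult.assoc mult.commute[of "\<kappa> ^ _"] flip: \<kappa>_def p_def)
  qed
qed

section \<open>The two laws and the final statement\<close>

lemma bounded_law_rademacher: "bounded_law rademacher"
proof -
  interpret prob_space rademacher
    unfolding rademacher_def by (rule prob_space_measure_pmf)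
  show ?thesis
  proof unfold_locales
    show "(\<lambda>x. x) \<in> borel_measurable rademacher"
      by (simp add: rademacher_def)
    show "AE x in rademacher. norm x \<le> 1"
      unfolding rademacher_def AE_measure_pmf_iff by (subst set_pmf_of_set) auto
  qed
qed

lemma bounded_law_steinhaus: "bounded_law steinhaus"
proof -
  have cis: "cis \<in> borel_measurable (uniform_measure lborel {0..2 * pi})"
    by (subst measurable_cong_sets[of _ lborel _ borel])
      (simp_all add: borel_measurable_continuous_onI continuous_on_cis)
  interpret U: prob_space "uniform_measure lborel {0..2 * pi}"
    by (rule prob_space_uniform_measure) simp_all
  interpret prob_space steinhaus
    unfolding steinhaus_def using cis by (rule U.prob_space_distr)
  show ?thesis
  proof unfold_locales
    show "(\<lambda>x. x) \<in> borel_measurable steinhaus"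
      by (simp add: steinhaus_def)
    show "AE x in steinhaus. norm x \<le> 1"
      unfolding steinhaus_def using cis by (subst AE_distr_iff) auto
  qed
qed

theorem proposition1:
  fixes n k :: nat and qs :: "real list"
  assumes "1 \<le> k" and "k \<le> n"
    and "length qs = n"
    and "card {j. j < n \<and> qs ! j = 2 * real k / (real k + 1)} = k"
    and "\<forall>j<n. qs ! j \<noteq> 2 * real k / (real k + 1) \<longrightarrow> qs ! j = 2"
  shows "mixed_const TYPE(real) qs
           \<le> bohnenblust_hille_const TYPE(real) k
              * inverse (ennreal (khinchin_const rademacher (2 * real k / (real k + 1)))) ^ (n - k)
       \<and> mixed_const TYPE(complex) qs
           \<le> bohnenblust_hille_const TYPE(complex) k
              * inverse (ennreal (khinchin_const steinhaus (2 * real k / (real k + 1)))) ^ (n - k)"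
  using bounded_law.mixed_const_le[OF bounded_law_rademacher assms]
    bounded_law.mixed_const_le[OF bounded_law_steinhaus assms] by simp

end
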